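(* Let $X$ be a Banach space. Then: (1) $\mathrm{Ball}(B(X))$ is compact in the weak operator topology if and only if $X$ is reflexive. (2) $\mathrm{Ball}(B(X))$ is compact in the strong operator topology if and only if $X$ is finite dimensional. (3) $\mathrm{Ball}(X^* )$ is $w^*$-compact.
   Context: $B(X)$ is the Banach algebra of bounded linear operators on $X$, and $\mathrm{Ball}(\cdot)$ denotes the closed unit ball. The weak (respectively strong) operator topology on $B(X)$ is the topology in which $T_\alpha\to T$ if and only if $T_\alpha(x)\to T(x)$ in the weak (respectively norm) topology of $X$ for every $x\in X$. *)

theory Defs
  imports "HOL-Analysis.Analysis"
begin

text \<open>
  A Banach space may be real or complex. The scalar field is a type of the class below, whose
  members are the isometric copies of \<open>\<real>\<close> and \<open>\<complex>\<close>.
\<close>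

class real_or_complex = real_normed_field +
  assumes real_or_complex:
    "(\<forall>z. \<exists>a. z = a *\<^sub>R 1) \<or>
     (\<exists>i. i * i = - 1 \<and> (\<forall>z. \<exists>a b. z = a *\<^sub>R 1 + b *\<^sub>R i) \<and>
          (\<forall>a b. norm (a *\<^sub>R 1 + b *\<^sub>R i) = sqrt (a\<^sup>2 + b\<^sup>2)))"

instance real :: real_or_complex
  by standard simp

instance complex :: real_or_complex
proof
  have "\<exists>a b. z = a *\<^sub>R 1 + b *\<^sub>R \<i>" for z
    by (rule exI[of _ "Re z"], rule exI[of _ "Im z"]) (simp add: complex_eq_iff)
  then have "\<i> * \<i> = - 1 \<and> (\<forall>z. \<exists>a b. z = a *\<^sub>R 1 + b *\<^sub>R \<i>) \<and>
      (\<forall>a b. norm (a *\<^sub>R 1 + b *\<^sub>R \<i>) = sqrt (a\<^sup>2 + b\<^sup>2))"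
    by (simp add: cmod_def)
  then show "(\<forall>z::complex. \<exists>a. z = a *\<^sub>R 1) \<or>
     (\<exists>i::complex. i * i = - 1 \<and> (\<forall>z. \<exists>a b. z = a *\<^sub>R 1 + b *\<^sub>R i) \<and>
          (\<forall>a b. norm (a *\<^sub>R 1 + b *\<^sub>R i) = sqrt (a\<^sup>2 + b\<^sup>2)))"
    by blast
qed

text \<open>
  The class \<^class>\<open>banach\<close> supplies addition, norm, completeness and real scalar multiplication;
  \<open>smul\<close> is multiplication by scalars of \<open>'k\<close>, so \<open>smul = scaleR\<close> for a real Banach space.
\<close>

locale banach_space = vector_space smul
  for smul :: "'k::real_or_complex \<Rightarrow> 'a::banach \<Rightarrow> 'a" +
  assumes smul_of_real: "smul (of_real r) x = r *\<^sub>R x"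
    and norm_smul: "norm (smul c x) = norm c * norm x"

lemma banach_space_scaleR: "banach_space (scaleR :: real \<Rightarrow> 'a::banach \<Rightarrow> 'a)"
  by unfold_locales (simp_all add: algebra_simps)

lemma banach_space_mult: "banach_space ((*) :: complex \<Rightarrow> complex \<Rightarrow> complex)"
  by unfold_locales (simp_all add: algebra_simps norm_mult scaleR_conv_of_real)

definition finite_dimensional :: "('k::real_or_complex \<Rightarrow> 'a::banach \<Rightarrow> 'a) \<Rightarrow> bool" where
  "finite_dimensional smul \<longleftrightarrow> (\<exists>B. finite B \<and> module.span smul B = UNIV)"

text \<open>
  The type of bounded real-linear maps carries the operator norm, which does not depend on the
  scalar field; \<open>B(X)\<close> and \<open>X*\<close> are the subspaces of maps linear over \<open>'k\<close>.
\<close>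

definition bounded_operators :: "('k::real_or_complex \<Rightarrow> 'a::banach \<Rightarrow> 'a) \<Rightarrow> ('a \<Rightarrow>\<^sub>L 'a) set" where
  "bounded_operators smul = {T. Vector_Spaces.linear smul smul (blinfun_apply T)}"

definition dual :: "('k::real_or_complex \<Rightarrow> 'a::banach \<Rightarrow> 'a) \<Rightarrow> ('a \<Rightarrow>\<^sub>L 'k) set" where
  "dual smul = {f. Vector_Spaces.linear smul (*) (blinfun_apply f)}"

text \<open>
  Since \<open>X*\<close> is a set rather than a type, elements of \<open>X**\<close> are functions on it, made
  \<^const>\<open>undefined\<close> elsewhere. The functional \<open>blinfun_mult_right c o\<^sub>L f\<close> is \<open>x \<mapsto> c * f x\<close>.
\<close>

definition bidual :: "('k::real_or_complex \<Rightarrow> 'a::banach \<Rightarrow> 'a) \<Rightarrow> (('a \<Rightarrow>\<^sub>L 'k) \<Rightarrow> 'k) set" where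
  "bidual smul = {\<phi> \<in> extensional (dual smul).
     (\<forall>f\<in>dual smul. \<forall>g\<in>dual smul. \<phi> (f + g) = \<phi> f + \<phi> g) \<and>
     (\<forall>c. \<forall>f\<in>dual smul. \<phi> (blinfun_mult_right c o\<^sub>L f) = c * \<phi> f) \<and>
     (\<exists>M. \<forall>f\<in>dual smul. norm (\<phi> f) \<le> M * norm f)}"

definition canonical_embedding ::
    "('k::real_or_complex \<Rightarrow> 'a::banach \<Rightarrow> 'a) \<Rightarrow> 'a \<Rightarrow> ('a \<Rightarrow>\<^sub>L 'k) \<Rightarrow> 'k" where
  "canonical_embedding smul x = (\<lambda>f\<in>dual smul. blinfun_apply f x)"

definition reflexive :: "('k::real_or_complex \<Rightarrow> 'a::banach \<Rightarrow> 'a) \<Rightarrow> bool" where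
  "reflexive smul \<longleftrightarrow> range (canonical_embedding smul) = bidual smul"

definition weak_topology :: "('k::real_or_complex \<Rightarrow> 'a::banach \<Rightarrow> 'a) \<Rightarrow> 'a topology" where
  "weak_topology smul =
     pullback_topology UNIV (canonical_embedding smul) (product_topology (\<lambda>_. euclidean) (dual smul))"

definition weak_star_topology :: "('k::real_or_complex \<Rightarrow> 'a::banach \<Rightarrow> 'a) \<Rightarrow> ('a \<Rightarrow>\<^sub>L 'k) topology" where
  "weak_star_topology smul =
     pullback_topology (dual smul) blinfun_apply (product_topology (\<lambda>_. euclidean) UNIV)"

text \<open>
  Like \<^const>\<open>strong_operator_topology\<close>, this is a topology on all bounded real-linear maps;
  it is to be used on subsets of \<open>B(X)\<close>.
\<close>

definition weak_operator_topology ::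
    "('k::real_or_complex \<Rightarrow> 'a::banach \<Rightarrow> 'a) \<Rightarrow> ('a \<Rightarrow>\<^sub>L 'a) topology" where
  "weak_operator_topology smul =
     pullback_topology UNIV blinfun_apply (product_topology (\<lambda>_. weak_topology smul) UNIV)"

text \<open>The four topologies are characterised by their convergent nets:\<close>

lemma limitin_pullback_topology:
  assumes "range f \<subseteq> topspace T"
  shows "limitin (pullback_topology A f T) g l F \<longleftrightarrow>
    l \<in> A \<and> eventually (\<lambda>a. g a \<in> A) F \<and> limitin T (\<lambda>a. f (g a)) (f l) F"
    (is "?L \<longleftrightarrow> ?R")
proof
  assume L: ?L
  then have l: "l \<in> A"
    by (simp add: limitin_def topspace_pullback_topology)
  have ev: "\<forall>\<^sub>F a in F. g a \<in> f -` U \<inter> A" if "openin T U" "f l \<in> U" for U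
  proof -
    have "openin (pullback_topology A f T) (f -` U \<inter> A)" "l \<in> f -` U \<inter> A"
      using that l by (auto simp: openin_pullback_topology)
    with L show ?thesis
      unfolding limitin_def by blast
  qed
  have "\<forall>\<^sub>F a in F. g a \<in> A"
    by (rule eventually_mono[OF ev[OF openin_topspace]]) (use assms in auto)
  moreover have "limitin T (\<lambda>a. f (g a)) (f l) F"
    unfolding limitin_def
  proof (intro conjI allI impI)
    show "f l \<in> topspace T"
      using assms by auto
    fix U assume "openin T U \<and> f l \<in> U"
    then show "\<forall>\<^sub>F a in F. f (g a) \<in> U"
      using ev[of U] by (simp add: eventually_conj_iff)
  qed
  ultimately show ?R
    using l by blast
next
  assume R: ?R
  show ?L
    unfolding limitin_def
  proof (intro conjI allI impI)
    show "l \<in> topspace (pullback_topology A f T)"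
      using R assms by (auto simp: topspace_pullback_topology)
    fix V assume "openin (pullback_topology A f T) V \<and> l \<in> V"
    then obtain U where "openin T U" "V = f -` U \<inter> A" "f l \<in> U"
      by (auto simp: openin_pullback_topology)
    then show "\<forall>\<^sub>F a in F. g a \<in> V"
      using R by (auto simp: limitin_def intro: eventually_conj)
  qed
qed

lemma topspace_weak_topology [simp]: "topspace (weak_topology smul) = UNIV"
  by (auto simp: weak_topology_def topspace_pullback_topology canonical_embedding_def)

lemma limitin_weak_topology:
  "limitin (weak_topology smul) g l F \<longleftrightarrow> (\<forall>f\<in>dual smul. ((\<lambda>a. blinfun_apply f (g a)) \<longlongrightarrow> f l) F)"
  unfolding weak_topology_def
  by (subst limitin_pullback_topology) (auto simp: limitin_componentwise canonical_embedding_def)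

lemma limitin_weak_star_topology:
  "limitin (weak_star_topology smul) g l F \<longleftrightarrow>
     l \<in> dual smul \<and> eventually (\<lambda>a. g a \<in> dual smul) F \<and>
     (\<forall>x. ((\<lambda>a. blinfun_apply (g a) x) \<longlongrightarrow> l x) F)"
  unfolding weak_star_topology_def
  by (subst limitin_pullback_topology) (auto simp: limitin_componentwise)

lemma limitin_weak_operator_topology:
  "limitin (weak_operator_topology smul) g l F \<longleftrightarrow>
     (\<forall>x. limitin (weak_topology smul) (\<lambda>a. blinfun_apply (g a) x) (l x) F)"
  unfolding weak_operator_topology_def
  by (subst limitin_pullback_topology) (auto simp: limitin_componentwise)

lemma limitin_strong_operator_topology:
  fixes l :: "'a::real_normed_vector \<Rightarrow>\<^sub>L 'b::real_normed_vector"
  shows "limitin strong_operator_topology g l F \<longleftrightarrow> (\<forall>x. ((\<lambda>a. blinfun_apply (g a) x) \<longlongrightarrow> l x) F)"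
proof -
  have *: "strong_operator_topology =
      pullback_topology UNIV blinfun_apply (product_topology (\<lambda>_::'a. euclidean :: 'b topology) UNIV)"
    by (simp only: strong_operator_topology_def euclidean_product_topology)
  show ?thesis
    unfolding *
    by (subst limitin_pullback_topology) (auto simp: limitin_componentwise)
qed

end

theory Submission
  imports Defs
begin

text \<open>
  The weak-star and both operator topologies are topologies of pointwise convergence, so the compactness half of each claim
  is Tychonoff's theorem. A linear map of norm at most \<open>1\<close> sends \<open>x\<close> into the ball of radius
  \<open>norm x\<close>; if the balls of the target are compact for a Hausdorff vector topology \<open>T\<close>, the product
  of these balls is compact, and linearity cuts out a closed subset of it
  (\<open>compactin_linear_ball\<close>). For \<open>T\<close> the norm topology of the scalars this is the theorem of
  Banach and Alaoglu, for \<open>T\<close> the norm topology of a finite-dimensional \<open>X\<close> it is one half of the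
  claim on the strong operator topology, and for \<open>T\<close> the weak topology of a reflexive \<open>X\<close> it is one
  half of the claim on the weak operator topology. In the last case the balls of \<open>X\<close> are weakly
  compact because they are the balls of \<open>X**\<close>, to which the same argument applies.

  Conversely, the rank-one operators \<open>v \<mapsto> f v / r * y\<close> show that evaluation at a vector \<open>x\<close> of norm
  \<open>r\<close> with \<open>f x = r\<close> maps the unit ball of \<open>B(X)\<close> onto the ball of radius \<open>r\<close> in \<open>X\<close>
  (\<open>compactin_cball_if_operator_ball\<close>). So the balls of \<open>X\<close> are compact in the weak or in the norm
  topology, respectively. Norm compactness forces finite dimension, as every vector of the unit ball
  is a series \<open>\<Sum>i. 2^-i b\<^sub>i\<close> with all \<open>b\<^sub>i\<close> in one finite set
  (\<open>finite_dimensional_if_compact_cball\<close>). Weak compactness forces reflexivity: given \<open>\<phi>\<close> in \<open>X**\<close>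
  and finitely many functionals \<open>f\<close>, a point \<open>y\<close> of a ball that minimises \<open>\<Sum>f. |\<phi> f - f y|^2\<close>
  must satisfy \<open>f y = \<phi> f\<close> for all of them (\<open>bidual_interpolation\<close>), and compactness allows all
  functionals to be handled at once.

  Both directions use that every vector has a norming functional. It comes from a Hahn-Banach
  argument in which the dominated linear functional is a minimal sublinear functional, so no partially
  defined functionals occur.
\<close>

section \<open>Linear functionals below a sublinear functional\<close>

definition sublinear :: "('a::real_vector \<Rightarrow> real) \<Rightarrow> bool" where
  "sublinear p \<longleftrightarrow> (\<forall>x y. p (x + y) \<le> p x + p y) \<and> (\<forall>t>0. \<forall>x. p (t *\<^sub>R x) \<le> t * p x)"

lemma sublinear_add: "sublinear p \<Longrightarrow> p (x + y) \<le> p x + p y"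
  by (simp add: sublinear_def)

lemma sublinear_zero:
  assumes "sublinear p"
  shows "p 0 = 0"
proof (rule antisym)
  have "p ((1/2) *\<^sub>R 0) \<le> (1/2) * p 0"
    using assms unfolding sublinear_def by (metis half_gt_zero zero_less_one)
  then show "p 0 \<le> 0" by simp
  show "0 \<le> p 0"
    using sublinear_add[OF assms, of 0 0] by simp
qed

lemma sublinear_scaleR:
  assumes "sublinear p" "0 \<le> t"
  shows "p (t *\<^sub>R x) = t * p x"
proof (cases "t = 0")
  case True
  then show ?thesis using sublinear_zero[OF assms(1)] by simp
next
  case False
  then have t: "t > 0" using assms by simp
  have "p (inverse t *\<^sub>R (t *\<^sub>R x)) \<le> inverse t * p (t *\<^sub>R x)"
    using assms(1) t unfolding sublinear_def by (meson positive_imp_inverse_positive)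
  then have "t * p x \<le> p (t *\<^sub>R x)"
    using t by (simp add: field_simps)
  moreover have "p (t *\<^sub>R x) \<le> t * p x"
    using assms(1) t unfolding sublinear_def by blast
  ultimately show ?thesis by simp
qed

lemma sublinear_minus: "sublinear p \<Longrightarrow> - p (- x) \<le> p x"
  using sublinear_add[of p x "- x"] sublinear_zero[of p] by simp

text \<open>
  The largest sublinear functional below \<open>p\<close> that takes a value at most \<open>- p y\<close> at \<open>- y\<close>. Thus
  if \<open>p\<close> is minimal, then \<open>p (- y) = - p y\<close>, which is all that separates sublinear from linear.
\<close>

definition tilt :: "('a::real_vector \<Rightarrow> real) \<Rightarrow> 'a \<Rightarrow> 'a \<Rightarrow> real" where
  "tilt p y x = (INF t\<in>{0..}. p (x + t *\<^sub>R y) - t * p y)"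

lemma tilt_bdd_below:
  assumes "sublinear p"
  shows "bdd_below ((\<lambda>t. p (x + t *\<^sub>R y) - t * p y) ` {0..})"
proof (rule bdd_belowI2)
  fix t :: real assume "t \<in> {0..}"
  then have "t * p y = p ((x + t *\<^sub>R y) + (- x))"
    using sublinear_scaleR[OF assms] by simp
  also have "\<dots> \<le> p (x + t *\<^sub>R y) + p (- x)"
    by (rule sublinear_add[OF assms])
  finally show "- p (- x) \<le> p (x + t *\<^sub>R y) - t * p y" by simp
qed

lemma tilt_le:
  assumes "sublinear p" "0 \<le> t"
  shows "tilt p y x \<le> p (x + t *\<^sub>R y) - t * p y"
  unfolding tilt_def by (rule cINF_lower[OF tilt_bdd_below[OF assms(1)]]) (use assms in auto)

lemma tilt_greatest:
  assumes "\<And>t. 0 \<le> t \<Longrightarrow> m \<le> p (x + t *\<^sub>R y) - t * p y"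
  shows "m \<le> tilt p y x"
  unfolding tilt_def by (rule cINF_greatest) (use assms in auto)

lemma sublinear_tilt:
  assumes p: "sublinear p"
  shows "sublinear (tilt p y)"
  unfolding sublinear_def
proof (intro conjI allI impI)
  fix x x'
  have "tilt p y (x + x') - tilt p y x' \<le> tilt p y x"
  proof (rule tilt_greatest)
    fix t :: real assume t: "0 \<le> t"
    have "tilt p y (x + x') - (p (x + t *\<^sub>R y) - t * p y) \<le> tilt p y x'"
    proof (rule tilt_greatest)
      fix s :: real assume s: "0 \<le> s"
      have "tilt p y (x + x') \<le> p ((x + x') + (t + s) *\<^sub>R y) - (t + s) * p y"
        using s t by (intro tilt_le[OF p]) simp
      also have "(x + x') + (t + s) *\<^sub>R y = (x + t *\<^sub>R y) + (x' + s *\<^sub>R y)"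
        by (simp add: algebra_simps)
      also have "p \<dots> - (t + s) * p y \<le> p (x + t *\<^sub>R y) + p (x' + s *\<^sub>R y) - (t + s) * p y"
        using sublinear_add[OF p] by simp
      finally show "tilt p y (x + x') - (p (x + t *\<^sub>R y) - t * p y) \<le> p (x' + s *\<^sub>R y) - s * p y"
        by (simp add: algebra_simps)
    qed
    then show "tilt p y (x + x') - tilt p y x' \<le> p (x + t *\<^sub>R y) - t * p y"
      by simp
  qed
  then show "tilt p y (x + x') \<le> tilt p y x + tilt p y x'" by simp
next
  fix s :: real and x assume s: "0 < s"
  have "tilt p y (s *\<^sub>R x) / s \<le> tilt p y x"
  proof (rule tilt_greatest)
    fix t :: real assume t: "0 \<le> t"
    have "tilt p y (s *\<^sub>R x) \<le> p (s *\<^sub>R x + (s * t) *\<^sub>R y) - (s * t) * p y"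
      using s t by (intro tilt_le[OF p]) simp
    also have "s *\<^sub>R x + (s * t) *\<^sub>R y = s *\<^sub>R (x + t *\<^sub>R y)"
      by (simp add: algebra_simps)
    also have "p \<dots> = s * p (x + t *\<^sub>R y)"
      using s by (intro sublinear_scaleR[OF p]) simp
    finally show "tilt p y (s *\<^sub>R x) / s \<le> p (x + t *\<^sub>R y) - t * p y"
      using s by (simp add: field_simps)
  qed
  then show "tilt p y (s *\<^sub>R x) \<le> s * tilt p y x"
    using s by (simp add: field_simps)
qed

text \<open>
  Zorn's lemma applies because the pointwise infimum of a chain is again sublinear: two members of a
  chain can be replaced by the smaller one, and \<open>- p (- x)\<close> bounds all their values at \<open>x\<close> from below.
\<close>

lemma minimal_sublinear_exists:
  fixes p :: "'a::real_vector \<Rightarrow> real"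
  assumes p: "sublinear p"
  obtains q where "sublinear q" "q \<le> p" "\<And>r. sublinear r \<Longrightarrow> r \<le> q \<Longrightarrow> r = q"
proof -
  define A where "A = {q. sublinear q \<and> q \<le> p}"
  have po: "partial_order_on A (relation_of (\<lambda>q r. r \<le> q) A)"
    by (auto simp: partial_order_on_def preorder_on_def refl_on_def trans_def antisym_def
        relation_of_def)
  have ub: "\<exists>u\<in>A. \<forall>q\<in>C. u \<le> q" if "C \<in> Chains (relation_of (\<lambda>q r. r \<le> q) A)" for C
  proof (cases "C = {}")
    case True
    then show ?thesis using p by (auto simp: A_def)
  next
    case False
    have CA: "C \<subseteq> A"
      using that by (auto simp: Chains_def relation_of_def)
    have chain: "q \<le> r \<or> r \<le> q" if "q \<in> C" "r \<in> C" for q r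
      using that \<open>C \<in> _\<close> by (auto simp: Chains_def relation_of_def)
    define u where "u = (\<lambda>x. INF q\<in>C. q x)"
    have bdd: "bdd_below ((\<lambda>q. q x) ` C)" for x
    proof (rule bdd_belowI2)
      fix q assume "q \<in> C"
      then have "sublinear q" "q (- x) \<le> p (- x)"
        using CA by (auto simp: A_def le_fun_def)
      then show "- p (- x) \<le> q x"
        using sublinear_minus[of q x] by simp
    qed
    have lower: "u x \<le> q x" if "q \<in> C" for q x
      unfolding u_def by (rule cINF_lower[OF bdd that])
    have greatest: "m \<le> u x" if "\<And>q. q \<in> C \<Longrightarrow> m \<le> q x" for m x
      unfolding u_def by (rule cINF_greatest[OF False that])
    have "sublinear u"
      unfolding sublinear_def
    proof (intro conjI allI impI)
      fix x y
      have "u (x + y) - u y \<le> u x"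
      proof (rule greatest)
        fix q assume q: "q \<in> C"
        have "u (x + y) - q x \<le> u y"
        proof (rule greatest)
          fix r assume r: "r \<in> C"
          obtain s where "s \<in> C" "s \<le> q" "s \<le> r"
            using chain[OF q r] q r by blast
          moreover have "s (x + y) \<le> s x + s y"
            using \<open>s \<in> C\<close> CA by (intro sublinear_add) (auto simp: A_def)
          ultimately show "u (x + y) - q x \<le> r y"
            using lower[of s "x + y"] le_funD[of s q x] le_funD[of s r y] by simp
        qed
        then show "u (x + y) - u y \<le> q x" by simp
      qed
      then show "u (x + y) \<le> u x + u y" by simp
    next
      fix t :: real and x assume t: "0 < t"
      have "u (t *\<^sub>R x) / t \<le> u x"
      proof (rule greatest)
        fix q assume q: "q \<in> C"
        then have "q (t *\<^sub>R x) = t * q x"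
          using CA t by (intro sublinear_scaleR) (auto simp: A_def)
        then show "u (t *\<^sub>R x) / t \<le> q x"
          using lower[OF q, of "t *\<^sub>R x"] t by (simp add: field_simps)
      qed
      then show "u (t *\<^sub>R x) \<le> t * u x"
        using t by (simp add: field_simps)
    qed
    moreover have "u \<le> p"
    proof (rule le_funI)
      fix x
      obtain q where q: "q \<in> C" using False by blast
      then have "q x \<le> p x" using CA by (auto simp: A_def le_fun_def)
      then show "u x \<le> p x" using lower[OF q, of x] by simp
    qed
    ultimately show ?thesis
      using lower by (auto simp: A_def le_fun_def)
  qed
  obtain q where "q \<in> A" "\<And>r. r \<in> A \<Longrightarrow> r \<le> q \<Longrightarrow> r = q"
    using predicate_Zorn[OF po ub] by blast
  then show thesis
    using order_trans[of _ q p] by (intro that[of q]) (auto simp: A_def)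
qed

lemma minimal_sublinear_is_linear:
  assumes q: "sublinear q" and min: "\<And>r. sublinear r \<Longrightarrow> r \<le> q \<Longrightarrow> r = q"
  shows "Real_Vector_Spaces.linear q"
proof -
  have neg: "q (- y) = - q y" for y
  proof -
    have "tilt q y x \<le> q x" for x
      using tilt_le[OF q, of 0 y x] by simp
    then have "tilt q y = q"
      by (intro min sublinear_tilt q) (simp add: le_fun_def)
    then have "q (- y) \<le> - q y"
      using tilt_le[OF q, of 1 y "- y"] sublinear_zero[OF q] by simp
    then show ?thesis
      using sublinear_minus[OF q, of y] by simp
  qed
  show ?thesis
  proof (rule linearI)
    fix x y
    have "q (- x + - y) \<le> q (- x) + q (- y)"
      by (rule sublinear_add[OF q])
    moreover have "q (- x + - y) = - q (x + y)"
      using neg[of "x + y"] by (simp add: algebra_simps)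
    ultimately show "q (x + y) = q x + q y"
      using sublinear_add[OF q, of x y] by (simp add: neg)
  next
    fix t x
    show "q (t *\<^sub>R x) = t *\<^sub>R q x"
    proof (cases "0 \<le> t")
      case True
      then show ?thesis using sublinear_scaleR[OF q] by simp
    next
      case False
      then have "q ((- t) *\<^sub>R x) = (- t) * q x"
        by (intro sublinear_scaleR[OF q]) simp
      then show ?thesis using neg[of "t *\<^sub>R x"] by simp
    qed
  qed
qed

text \<open>
  A linear functional below \<open>tilt p x\<close> is below \<open>p\<close>, and it is at most \<open>- p x\<close> at \<open>- x\<close>, hence at
  least \<open>p x\<close> at \<open>x\<close>.
\<close>

lemma linear_below_sublinear_touching:
  assumes p: "sublinear p"
  obtains u where "Real_Vector_Spaces.linear u" "\<And>y. u y \<le> p y" "u x = p x"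
proof -
  obtain q where q: "sublinear q" "q \<le> tilt p x" "\<And>r. sublinear r \<Longrightarrow> r \<le> q \<Longrightarrow> r = q"
    using minimal_sublinear_exists[OF sublinear_tilt[OF p]] by blast
  then have lin: "Real_Vector_Spaces.linear q"
    by (intro minimal_sublinear_is_linear)
  have le: "q y \<le> p y" for y
    using order_trans[OF le_funD[OF q(2)] tilt_le[OF p, of 0 x y]] by simp
  have "q (- x) \<le> - p x"
    using order_trans[OF le_funD[OF q(2)] tilt_le[OF p, of 1 x "- x"]] sublinear_zero[OF p] by simp
  then have "p x \<le> q x"
    using linear_neg[OF lin, of x] by simp
  then show thesis
    using le[of x] by (intro that[OF lin]) (auto intro: le)
qed

section \<open>Real parts of scalars\<close>

text \<open>
  The polarisation formula for the inner product of \<open>1\<close> and \<open>z\<close>. It refers to the norm only, and so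
  covers real and complex scalars without a choice of an imaginary unit.
\<close>

definition real_part :: "'k::real_normed_field \<Rightarrow> real" where
  "real_part z = (1 + (norm z)\<^sup>2 - (norm (1 - z))\<^sup>2) / 2"

lemma linear_real_part: "Real_Vector_Spaces.linear (real_part :: 'k::real_or_complex \<Rightarrow> real)"
  using real_or_complex[where 'a = 'k]
proof (elim disjE exE conjE)
  assume R: "\<forall>z::'k. \<exists>a. z = a *\<^sub>R 1"
  have *: "real_part (a *\<^sub>R 1 :: 'k) = a" for a
  proof -
    have "(1::'k) - a *\<^sub>R 1 = (1 - a) *\<^sub>R 1"
      by (simp add: algebra_simps)
    then have "norm ((1::'k) - a *\<^sub>R 1) = \<bar>1 - a\<bar>"
      by (simp only: norm_scaleR norm_one mult_1_right)
    then show ?thesis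
      unfolding real_part_def by (simp add: power2_eq_square algebra_simps)
  qed
  show ?thesis
  proof (rule linearI)
    fix z w :: 'k and t :: real
    obtain a b where "z = a *\<^sub>R 1" "w = b *\<^sub>R 1" using R by metis
    then show "real_part (z + w) = real_part z + real_part w" "real_part (t *\<^sub>R z) = t *\<^sub>R real_part z"
      by (simp_all add: * flip: scaleR_left_distrib)
  qed
next
  fix i :: 'k
  assume C: "\<forall>z. \<exists>a b. z = a *\<^sub>R 1 + b *\<^sub>R i"
    and N: "\<forall>a b. norm (a *\<^sub>R 1 + b *\<^sub>R i) = sqrt (a\<^sup>2 + b\<^sup>2)"
  have *: "real_part (a *\<^sub>R 1 + b *\<^sub>R i) = a" for a b
  proof -
    have "1 - (a *\<^sub>R 1 + b *\<^sub>R i) = (1 - a) *\<^sub>R 1 + (- b) *\<^sub>R i"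
      by (simp add: algebra_simps)
    then show ?thesis
      unfolding real_part_def
      by (simp only: N real_sqrt_pow2 sum_power2_ge_zero) (simp add: power2_eq_square algebra_simps)
  qed
  show ?thesis
  proof (rule linearI)
    fix z w :: 'k and t :: real
    obtain a b a' b' where zw: "z = a *\<^sub>R 1 + b *\<^sub>R i" "w = a' *\<^sub>R 1 + b' *\<^sub>R i" using C by metis
    have "z + w = (a + a') *\<^sub>R 1 + (b + b') *\<^sub>R i" "t *\<^sub>R z = (t * a) *\<^sub>R 1 + (t * b) *\<^sub>R i"
      by (simp_all add: zw algebra_simps)
    then show "real_part (z + w) = real_part z + real_part w" "real_part (t *\<^sub>R z) = t *\<^sub>R real_part z"
      by (simp_all only: * zw) simp
  qed
qed

lemmas real_part_add = linear_add[OF linear_real_part]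
lemmas real_part_scaleR = linear_cmul[OF linear_real_part]
lemmas real_part_sum = linear_sum[OF linear_real_part]

lemma real_part_of_real [simp]: "real_part (of_real r :: 'k::real_or_complex) = r"
proof -
  have "real_part (1::'k) = 1"
    by (simp add: real_part_def)
  then show ?thesis
    using real_part_scaleR[of r "1::'k"] by (simp add: of_real_def)
qed

lemma real_part_le_norm: "real_part z \<le> norm (z::'k::real_or_complex)"
proof -
  have "\<bar>1 - norm z\<bar> \<le> norm (1 - z)"
    using norm_triangle_ineq3[of 1 z] by simp
  then have "(1 - norm z)\<^sup>2 \<le> (norm (1 - z))\<^sup>2"
    by (metis abs_ge_zero power2_abs power_mono)
  then show ?thesis
    by (simp add: real_part_def power2_eq_square algebra_simps)
qed

text \<open>
  The factor \<open>of_real ((norm d)\<^sup>2) / d\<close> is the complex conjugate of \<open>d\<close>, so this is the expansion of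
  the square of a norm in an inner product space.
\<close>

lemma norm_diff_scaleR_square:
  fixes d w :: "'k::real_or_complex"
  shows "(norm (d - t *\<^sub>R w))\<^sup>2 =
    (norm d)\<^sup>2 - 2 * t * real_part (of_real ((norm d)\<^sup>2) / d * w) + t\<^sup>2 * (norm w)\<^sup>2"
proof (cases "d = 0")
  case True
  then show ?thesis
    using real_part_of_real[of 0, where 'k = 'k] by (simp add: power_mult_distrib)
next
  case False
  have "(norm (1 - z))\<^sup>2 = 1 - 2 * real_part z + (norm z)\<^sup>2" for z :: 'k
    by (simp add: real_part_def field_simps)
  from this[of "t *\<^sub>R (w / d)"]
  have e: "(norm (1 - t *\<^sub>R (w / d)))\<^sup>2 = 1 - 2 * (t * real_part (w / d)) + t\<^sup>2 * (norm (w / d))\<^sup>2"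
    by (simp add: real_part_scaleR power_mult_distrib)
  have "d - t *\<^sub>R w = d * (1 - t *\<^sub>R (w / d))"
    using False by (simp add: algebra_simps)
  then have "(norm (d - t *\<^sub>R w))\<^sup>2 = (norm d)\<^sup>2 * (norm (1 - t *\<^sub>R (w / d)))\<^sup>2"
    by (simp add: norm_mult power_mult_distrib)
  also have "\<dots> = (norm d)\<^sup>2 - 2 * t * ((norm d)\<^sup>2 * real_part (w / d)) + t\<^sup>2 * (norm w)\<^sup>2"
    using False unfolding e by (simp add: norm_divide field_simps)
  also have "(norm d)\<^sup>2 * real_part (w / d) = real_part (of_real ((norm d)\<^sup>2) / d * w)"
    using real_part_scaleR[of "(norm d)\<^sup>2" "w / d"] by (simp add: scaleR_conv_of_real)
  finally show ?thesis .
qed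

lemma eq_of_real_if_norm_le_real_part:
  fixes z :: "'k::real_or_complex"
  assumes "real_part z = r" "norm z \<le> r"
  shows "z = of_real r"
proof -
  have "(norm (of_real r - 1 *\<^sub>R z))\<^sup>2 = r\<^sup>2 - 2 * real_part (of_real (r\<^sup>2) / of_real r * z) + (norm z)\<^sup>2"
    by (subst norm_diff_scaleR_square) simp
  also have "of_real (r\<^sup>2) / of_real r * z = r *\<^sub>R z"
    by (cases "r = 0") (simp_all add: power2_eq_square scaleR_conv_of_real)
  finally have "(norm (of_real r - z))\<^sup>2 = (norm z)\<^sup>2 - r\<^sup>2"
    using assms(1) by (simp add: real_part_scaleR power2_eq_square)
  also have "\<dots> \<le> 0"
    using assms(2) by (simp add: power_mono)
  finally show ?thesis by simp
qed

text \<open>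
  The scalars have real dimension at most two, with coordinates bounded by the norm.
\<close>

lemma compact_cball_scalar: "compact (cball (0::'k::real_or_complex) r)"
proof -
  obtain i :: 'k where
    C: "\<forall>z. \<exists>a b. z = a *\<^sub>R 1 + b *\<^sub>R i \<and> \<bar>a\<bar> \<le> norm z \<and> \<bar>b\<bar> \<le> norm z"
    using real_or_complex[where 'a = 'k]
  proof (elim disjE exE conjE)
    assume R: "\<forall>z::'k. \<exists>a. z = a *\<^sub>R 1"
    have "\<exists>a b. z = a *\<^sub>R 1 + b *\<^sub>R 0 \<and> \<bar>a\<bar> \<le> norm z \<and> \<bar>b\<bar> \<le> norm z" for z :: 'k
    proof -
      obtain a where "z = a *\<^sub>R 1" using R by metis
      then show ?thesis
        by (intro exI[of _ a] exI[of _ 0]) simp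
    qed
    then show thesis using that[of 0] by blast
  next
    fix i :: 'k
    assume C: "\<forall>z. \<exists>a b. z = a *\<^sub>R 1 + b *\<^sub>R i"
      and N: "\<forall>a b. norm (a *\<^sub>R 1 + b *\<^sub>R i) = sqrt (a\<^sup>2 + b\<^sup>2)"
    then have "\<exists>a b. z = a *\<^sub>R 1 + b *\<^sub>R i \<and> \<bar>a\<bar> \<le> norm z \<and> \<bar>b\<bar> \<le> norm z" for z
    proof -
      obtain a b where "z = a *\<^sub>R 1 + b *\<^sub>R i" using C by metis
      moreover from this have "norm z = sqrt (a\<^sup>2 + b\<^sup>2)" using N by simp
      ultimately show ?thesis
        by (intro exI[of _ a] exI[of _ b]) simp
    qed
    then show thesis using that[of i] by blast
  qed
  have "compact ((\<lambda>(a, b). a *\<^sub>R 1 + b *\<^sub>R i) ` ({- r..r} \<times> {- r..r}))"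
    unfolding case_prod_unfold by (intro compact_continuous_image compact_Times continuous_intros) auto
  moreover have "cball 0 r \<subseteq> (\<lambda>(a, b). a *\<^sub>R 1 + b *\<^sub>R i) ` ({- r..r} \<times> {- r..r})"
  proof
    fix z :: 'k assume "z \<in> cball 0 r"
    moreover obtain a b where "z = a *\<^sub>R 1 + b *\<^sub>R i" "\<bar>a\<bar> \<le> norm z" "\<bar>b\<bar> \<le> norm z"
      using C by metis
    ultimately show "z \<in> (\<lambda>(a, b). a *\<^sub>R 1 + b *\<^sub>R i) ` ({- r..r} \<times> {- r..r})"
      by (intro image_eqI[of _ _ "(a, b)"]) auto
  qed
  ultimately show ?thesis
    by (metis closed_cball compact_Int_closed inf.absorb_iff2)
qed

section \<open>Norming functionals\<close>

lemma vector_space_times: "vector_space ((*) :: 'k::field \<Rightarrow> 'k \<Rightarrow> 'k)"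
  by unfold_locales (simp_all add: algebra_simps)

lemma (in banach_space) in_dual_iff:
  "f \<in> dual smul \<longleftrightarrow> (\<forall>c x. blinfun_apply f (smul c x) = c * blinfun_apply f x)"
  using vector_space_axioms vector_space_times[where 'k = 'k]
  by (simp add: dual_def Vector_Spaces.linear_iff blinfun.add_right)

lemma (in banach_space) smul_scaleR: "smul c (r *\<^sub>R x) = r *\<^sub>R smul c x"
  by (metis smul_of_real scale_left_commute)

text \<open>
  Over complex scalars the functional is \<open>f x = u x - u (i x) * i\<close>; over real scalars it is \<open>u\<close>
  itself.
\<close>

lemma (in banach_space) scalar_linear_with_real_part:
  assumes u: "Real_Vector_Spaces.linear u"
  obtains f :: "'a \<Rightarrow> 'k"
  where "\<And>x y. f (x + y) = f x + f y" "\<And>c x. f (smul c x) = c * f x" "\<And>x. real_part (f x) = u x"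
  using real_or_complex[where 'a = 'k]
proof (elim disjE exE conjE)
  assume R: "\<forall>z::'k. \<exists>a. z = a *\<^sub>R 1"
  show thesis
  proof (rule that[of "\<lambda>x. of_real (u x)"])
    show "of_real (u (smul c x)) = c * (of_real (u x) :: 'k)" for c x
    proof -
      obtain a where "c = of_real a" using R unfolding of_real_def by metis
      then show ?thesis
        by (simp add: smul_of_real linear_cmul[OF u])
    qed
  qed (simp_all add: linear_add[OF u])
next
  fix i :: 'k
  assume i: "i * i = - 1" and C: "\<forall>z. \<exists>a b. z = a *\<^sub>R 1 + b *\<^sub>R i"
    and N: "\<forall>a b. norm (a *\<^sub>R 1 + b *\<^sub>R i) = sqrt (a\<^sup>2 + b\<^sup>2)"
  have rei: "real_part i = 0"
  proof -
    have "norm i = 1" "norm (1 - i) = sqrt 2"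
      using N[rule_format, of 0 1] N[rule_format, of 1 "- 1"] by simp_all
    then show ?thesis by (simp add: real_part_def)
  qed
  let ?f = "\<lambda>x. of_real (u x) - u (smul i x) *\<^sub>R i"
  show thesis
  proof (rule that[of ?f])
    show add: "?f (x + y) = ?f x + ?f y" for x y
      by (simp add: linear_add[OF u] scale_right_distrib algebra_simps)
    have fi: "?f (smul i x) = i * ?f x" for x
    proof -
      have *: "smul i (smul i x) = - x"
        by (simp add: i)
      have "i * (u (smul i x) *\<^sub>R i) = - of_real (u (smul i x))"
        by (simp add: i of_real_def)
      then show ?thesis
        unfolding * by (simp add: linear_neg[OF u] algebra_simps scaleR_conv_of_real)
    qed
    have fr: "?f (r *\<^sub>R x) = r *\<^sub>R ?f x" for r x
      by (simp add: smul_scaleR linear_cmul[OF u] algebra_simps scaleR_conv_of_real)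
    show "?f (smul c x) = c * ?f x" for c x
    proof -
      obtain a b where c: "c = a *\<^sub>R 1 + b *\<^sub>R i" using C by metis
      have "smul c x = a *\<^sub>R x + b *\<^sub>R smul i x"
        by (simp add: c scale_left_distrib scaleR_conv_of_real smul_of_real flip: scale_scale)
      then have "?f (smul c x) = a *\<^sub>R ?f x + b *\<^sub>R ?f (smul i x)"
        by (simp only: add fr)
      also have "\<dots> = c * ?f x"
        unfolding fi by (simp add: c scaleR_conv_of_real algebra_simps)
      finally show ?thesis .
    qed
    show "real_part (?f x) = u x" for x
      using linear_diff[OF linear_real_part, of "of_real (u x)" "u (smul i x) *\<^sub>R i"]
      by (simp add: real_part_scaleR rei)
  qed
qed

text \<open>
  A bound on the real part of a scalar-linear functional bounds the functional, because each value can
  be rotated onto the nonnegative reals. At \<open>x\<close> the real part already attains the bound \<open>norm x\<close>, so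
  there is no room for an imaginary part.
\<close>

lemma (in banach_space) norming_functional:
  obtains f where "f \<in> dual smul" "norm f \<le> 1" "blinfun_apply f x = of_real (norm x)"
proof -
  have "sublinear (norm :: 'a \<Rightarrow> real)"
    by (simp add: sublinear_def norm_triangle_ineq)
  then obtain u where u: "Real_Vector_Spaces.linear u" "\<And>y. u y \<le> norm y" "u x = norm x"
    using linear_below_sublinear_touching[of norm x] by blast
  obtain f :: "'a \<Rightarrow> 'k" where f: "\<And>x y. f (x + y) = f x + f y" "\<And>c x. f (smul c x) = c * f x"
    "\<And>x. real_part (f x) = u x"
    using scalar_linear_with_real_part[OF u(1)] by blast
  have bound: "norm (f y) \<le> norm y" for y
  proof (cases "f y = 0")
    case False
    define c where "c = of_real (norm (f y)) / f y"
    have c: "norm c = 1" "c * f y = of_real (norm (f y))"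
      using False by (simp_all add: c_def norm_divide)
    then have "norm (f y) = u (smul c y)"
      by (metis f(2,3) real_part_of_real)
    also have "\<dots> \<le> norm (smul c y)" by (rule u)
    finally show ?thesis by (simp add: norm_smul c)
  qed simp
  have bl: "bounded_linear f"
  proof (rule bounded_linear_intro[where K = 1])
    show "f (r *\<^sub>R y) = r *\<^sub>R f y" for r y
      by (metis f(2) scaleR_conv_of_real smul_of_real)
  qed (use f bound in auto)
  show thesis
  proof (rule that[of "Blinfun f"])
    show "Blinfun f \<in> dual smul"
      by (simp add: in_dual_iff bounded_linear_Blinfun_apply[OF bl] f)
    show "norm (Blinfun f) \<le> 1"
      by (rule norm_blinfun_bound) (simp_all add: bounded_linear_Blinfun_apply[OF bl] bound)
    show "blinfun_apply (Blinfun f) x = of_real (norm x)"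
      using f(3)[of x] bound[of x] u(3) eq_of_real_if_norm_le_real_part[of "f x" "norm x"]
      by (simp add: bounded_linear_Blinfun_apply[OF bl])
  qed
qed

section \<open>Compactness in topologies of pointwise convergence\<close>

text \<open>
  Tychonoff's theorem for the points of a product of compact sets that satisfy a family of equations
  \<open>p \<phi> = q \<phi>\<close> with continuous sides. The equations will express linearity.
\<close>

lemma compactin_PiE_equalizers:
  assumes T: "Hausdorff_space T" and C: "\<And>i. i \<in> I \<Longrightarrow> compactin T (C i)"
    and R: "\<And>p q. (p, q) \<in> R \<Longrightarrow> continuous_map (product_topology (\<lambda>_. T) I) T p \<and>
                 continuous_map (product_topology (\<lambda>_. T) I) T q"
  shows "compactin (product_topology (\<lambda>_. T) I) {\<phi> \<in> PiE I C. \<forall>(p, q)\<in>R. p \<phi> = q \<phi>}"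
proof -
  let ?P = "product_topology (\<lambda>_. T) I"
  let ?Z = "\<Inter>(insert (topspace ?P) ((\<lambda>(p, q). {\<phi> \<in> topspace ?P. p \<phi> = q \<phi>}) ` R))"
  have cpt: "compactin ?P (PiE I C)"
    using C by (simp add: compactin_PiE)
  have "closedin ?P ?Z"
    using R by (intro closedin_Inter)
      (auto simp del: topspace_product_topology intro!: closedin_continuous_maps_eq[OF T])
  then have "compactin ?P (?Z \<inter> PiE I C)"
    using cpt by (rule closed_Int_compactin)
  also have "?Z \<inter> PiE I C = {\<phi> \<in> PiE I C. \<forall>(p, q)\<in>R. p \<phi> = q \<phi>}"
    using compactin_subset_topspace[OF cpt] by auto
  finally show ?thesis .
qed

lemma compactin_pullback_topology:
  assumes "K \<subseteq> A" "compactin T (f ` K)"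
  shows "compactin (pullback_topology A f T) K"
  unfolding compactin_def
proof (intro conjI allI impI)
  show "K \<subseteq> topspace (pullback_topology A f T)"
    using assms compactin_subset_topspace by (fastforce simp: topspace_pullback_topology)
  fix \<U> assume U: "(\<forall>U\<in>\<U>. openin (pullback_topology A f T) U) \<and> K \<subseteq> \<Union>\<U>"
  then have "\<forall>U\<in>\<U>. \<exists>V. openin T V \<and> U = f -` V \<inter> A"
    by (simp add: openin_pullback_topology)
  then obtain V where V: "\<And>U. U \<in> \<U> \<Longrightarrow> openin T (V U)" "\<And>U. U \<in> \<U> \<Longrightarrow> U = f -` V U \<inter> A"
    by metis
  have "f ` K \<subseteq> \<Union>(V ` \<U>)"
  proof
    fix y assume "y \<in> f ` K"
    then obtain x U where "x \<in> K" "y = f x" "U \<in> \<U>" "x \<in> U"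
      using U by blast
    then show "y \<in> \<Union>(V ` \<U>)" using V(2) by blast
  qed
  then obtain \<F> where "finite \<F>" "\<F> \<subseteq> V ` \<U>" "f ` K \<subseteq> \<Union>\<F>"
    using assms(2) V(1) unfolding compactin_def by (metis (no_types, lifting) imageE)
  then obtain \<G> where G: "\<G> \<subseteq> \<U>" "finite \<G>" "f ` K \<subseteq> \<Union>(V ` \<G>)"
    by (metis finite_subset_image)
  have "K \<subseteq> \<Union>\<G>"
  proof
    fix x assume x: "x \<in> K"
    then obtain U where "U \<in> \<G>" "f x \<in> V U" using G(3) by blast
    moreover from this have "x \<in> U" using V(2)[of U] G(1) x assms(1) by blast
    ultimately show "x \<in> \<Union>\<G>" by blast
  qed
  then show "\<exists>\<F>. finite \<F> \<and> \<F> \<subseteq> \<U> \<and> K \<subseteq> \<Union>\<F>"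
    using G by blast
qed

text \<open>
  The common source of all three compactness results: a bounded operator is identified with its
  family of values, and the unit ball becomes the set of linear points of a product of balls. That
  addition and scaling are \<open>T\<close>-continuous makes this set closed. The set \<open>A\<close> is arbitrary because
  the weak-star topology lives on the dual only, and the operator topologies on all bounded
  real-linear maps.
\<close>

lemma (in banach_space) compactin_linear_ball:
  fixes s :: "'k \<Rightarrow> 'b::real_normed_vector \<Rightarrow> 'b" and T :: "'b topology"
  assumes s: "vector_space s" "\<And>r y. s (of_real r) y = r *\<^sub>R y"
    and T: "Hausdorff_space T"
    and add: "\<And>(X :: ('a \<Rightarrow> 'b) topology) f g. continuous_map X T f \<Longrightarrow> continuous_map X T g \<Longrightarrow>
                continuous_map X T (\<lambda>x. f x + g x)"
    and scale: "\<And>(X :: ('a \<Rightarrow> 'b) topology) f c. continuous_map X T f \<Longrightarrow>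
                continuous_map X T (\<lambda>x. s c (f x))"
    and cball: "\<And>r. compactin T (cball 0 r)"
    and A: "{f. Vector_Spaces.linear smul s (blinfun_apply f)} \<subseteq> A"
  shows "compactin (pullback_topology A blinfun_apply (product_topology (\<lambda>_. T) UNIV))
           ({f. Vector_Spaces.linear smul s (blinfun_apply f)} \<inter> cball 0 1)"
proof (rule compactin_pullback_topology)
  let ?L = "{f. Vector_Spaces.linear smul s (blinfun_apply f)} \<inter> cball 0 1"
  \<comment> \<open>the two sides of the equations that define linearity\<close>
  let ?R = "range (\<lambda>(x, y). (\<lambda>\<phi>. \<phi> (x + y), \<lambda>\<phi>. \<phi> x + \<phi> y)) \<union>
            range (\<lambda>(c, x). (\<lambda>\<phi>. \<phi> (smul c x), \<lambda>\<phi>. s c (\<phi> x)))"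
  let ?K = "{\<phi> \<in> PiE UNIV (\<lambda>x::'a. cball (0::'b) (norm x)). \<forall>(p, q)\<in>?R. p \<phi> = q \<phi>}"
  show "?L \<subseteq> A" using A by blast
  have lin: "Vector_Spaces.linear smul s \<phi> \<longleftrightarrow>
      (\<forall>x y. \<phi> (x + y) = \<phi> x + \<phi> y) \<and> (\<forall>c x. \<phi> (smul c x) = s c (\<phi> x))" for \<phi>
    using vector_space_axioms s(1) by (simp add: Vector_Spaces.linear_iff)
  have K: "\<phi> \<in> ?K \<longleftrightarrow> Vector_Spaces.linear smul s \<phi> \<and> (\<forall>x. norm (\<phi> x) \<le> norm x)" for \<phi>
    by (auto simp: lin ball_Un)
  have "compactin (product_topology (\<lambda>_. T) UNIV) ?K"
    by (rule compactin_PiE_equalizers[OF T])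
       (auto intro!: add scale cball continuous_map_product_projection)
  moreover have "blinfun_apply ` ?L = ?K"
  proof (intro set_eqI iffI)
    fix \<phi> assume "\<phi> \<in> blinfun_apply ` ?L"
    then obtain f where f: "\<phi> = blinfun_apply f" "Vector_Spaces.linear smul s f" "norm f \<le> 1"
      by auto
    have "norm (f x) \<le> norm x" for x
      using norm_blinfun[of f x] mult_right_mono[OF f(3), of "norm x"] by simp
    then show "\<phi> \<in> ?K" unfolding K using f by simp
  next
    fix \<phi> assume "\<phi> \<in> ?K"
    then have \<phi>: "Vector_Spaces.linear smul s \<phi>" "\<And>x. norm (\<phi> x) \<le> norm x"
      unfolding K by auto
    have bl: "bounded_linear \<phi>"
    proof (rule bounded_linear_intro[where K = 1])
      show "\<phi> (r *\<^sub>R x) = r *\<^sub>R \<phi> x" for r x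
        using \<phi>(1) unfolding lin by (metis smul_of_real s(2))
    qed (use \<phi> in \<open>auto simp: lin\<close>)
    have "norm (Blinfun \<phi>) \<le> 1"
      by (rule norm_blinfun_bound) (simp_all add: bounded_linear_Blinfun_apply[OF bl] \<phi>)
    then show "\<phi> \<in> blinfun_apply ` ?L"
      using \<phi>(1)
      by (intro image_eqI[of _ _ "Blinfun \<phi>"]) (auto simp: bounded_linear_Blinfun_apply[OF bl])
  qed
  ultimately show "compactin (product_topology (\<lambda>_. T) UNIV) (blinfun_apply ` ?L)"
    by simp
qed

lemma continuous_map_compose_continuous_on:
  assumes "continuous_on UNIV h" "continuous_map X euclidean f"
  shows "continuous_map X euclidean (\<lambda>x. h (f x))"
proof -
  have "continuous_map euclidean euclidean h"
    using assms(1) by simp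
  from continuous_map_compose[OF assms(2) this] show ?thesis
    by (simp add: o_def)
qed

lemmas continuous_map_mult_left =
  continuous_map_compose_continuous_on[OF linear_continuous_on[OF bounded_linear_mult_right]]

lemma (in banach_space) bounded_linear_smul: "bounded_linear (smul c)"
  by (rule bounded_linear_intro[where K = "norm c"])
     (simp_all add: scale_right_distrib smul_scaleR norm_smul)

theorem (in banach_space) compactin_dual_ball:
  "compactin (weak_star_topology smul) (dual smul \<inter> cball 0 1)"
  unfolding weak_star_topology_def dual_def
  by (rule compactin_linear_ball)
     (auto simp: vector_space_times scaleR_conv_of_real compact_cball_scalar
        intro!: continuous_map_add continuous_map_mult_left)

section \<open>The weak topology\<close>

lemma continuous_map_weak_topology:
  "continuous_map X (weak_topology smul) g \<longleftrightarrow>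
     (\<forall>f\<in>dual smul. continuous_map X euclidean (\<lambda>x. blinfun_apply f (g x)))"
proof
  assume g: "continuous_map X (weak_topology smul) g"
  show "\<forall>f\<in>dual smul. continuous_map X euclidean (\<lambda>x. blinfun_apply f (g x))"
  proof
    fix f assume f: "f \<in> dual smul"
    have "continuous_map (weak_topology smul) euclidean ((\<lambda>\<phi>. \<phi> f) \<circ> canonical_embedding smul)"
      unfolding weak_topology_def
      by (intro continuous_map_pullback continuous_map_product_projection f)
    from continuous_map_compose[OF g this]
    show "continuous_map X euclidean (\<lambda>x. blinfun_apply f (g x))"
      using f by (simp add: o_def canonical_embedding_def)
  qed
next
  assume "\<forall>f\<in>dual smul. continuous_map X euclidean (\<lambda>x. blinfun_apply f (g x))"
  then show "continuous_map X (weak_topology smul) g"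
    unfolding weak_topology_def
    by (intro continuous_map_pullback')
       (auto simp: continuous_map_componentwise canonical_embedding_def o_def)
qed

lemma continuous_map_dual:
  assumes "f \<in> dual smul"
  shows "continuous_map (weak_topology smul) euclidean (blinfun_apply f)"
  using continuous_map_weak_topology[of "weak_topology smul" smul "\<lambda>x. x"] assms by simp

lemma (in banach_space) Hausdorff_weak_topology: "Hausdorff_space (weak_topology smul)"
  unfolding Hausdorff_space_def
proof (intro allI impI)
  fix x y :: 'a
  assume "x \<in> topspace (weak_topology smul) \<and> y \<in> topspace (weak_topology smul) \<and> x \<noteq> y"
  moreover obtain f where f: "f \<in> dual smul" "blinfun_apply f (x - y) = of_real (norm (x - y))"
    using norming_functional by blast
  ultimately have "blinfun_apply f x \<noteq> blinfun_apply f y"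
    by (auto simp: blinfun.diff_right)
  then obtain U V where "open U" "open V" "blinfun_apply f x \<in> U" "blinfun_apply f y \<in> V" "U \<inter> V = {}"
    using hausdorff by metis
  moreover have "openin (weak_topology smul) {z. blinfun_apply f z \<in> W}" if "open W" for W
    using openin_continuous_map_preimage[OF continuous_map_dual[OF f(1)], of W] that by simp
  ultimately show "\<exists>U V. openin (weak_topology smul) U \<and> openin (weak_topology smul) V \<and>
      x \<in> U \<and> y \<in> V \<and> disjnt U V"
    by (intro exI[of _ "{z. blinfun_apply f z \<in> U}"] exI[of _ "{z. blinfun_apply f z \<in> V}"])
       (auto simp: disjnt_def)
qed

lemma (in banach_space) compactin_weak_operator_ball:
  assumes "\<And>r. compactin (weak_topology smul) (cball 0 r)"
  shows "compactin (weak_operator_topology smul) (bounded_operators smul \<inter> cball 0 1)"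
  unfolding weak_operator_topology_def bounded_operators_def
  by (rule compactin_linear_ball)
     (auto simp: assms vector_space_axioms smul_of_real Hausdorff_weak_topology
        continuous_map_weak_topology blinfun.add_right in_dual_iff
        intro!: continuous_map_add continuous_map_mult_left)

lemma strong_operator_topology_pullback:
  "(strong_operator_topology :: ('a::real_normed_vector \<Rightarrow>\<^sub>L 'b::real_normed_vector) topology) =
     pullback_topology UNIV blinfun_apply (product_topology (\<lambda>_. euclidean) UNIV)"
  by (simp only: strong_operator_topology_def euclidean_product_topology)

lemma (in banach_space) compactin_strong_operator_ball:
  assumes "\<And>r. compact (cball (0::'a) r)"
  shows "compactin strong_operator_topology (bounded_operators smul \<inter> cball 0 1)"
  unfolding strong_operator_topology_pullback bounded_operators_def
  by (rule compactin_linear_ball)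
     (auto simp: assms vector_space_axioms smul_of_real 
        intro!: continuous_map_add 
          continuous_map_compose_continuous_on[OF linear_continuous_on[OF bounded_linear_smul]])

text \<open>
  Evaluation at a vector \<open>x\<close> of norm \<open>r\<close> is continuous and maps the unit ball of \<open>B(X)\<close> into the
  ball of radius \<open>r\<close>. It is onto: if \<open>f\<close> is a norming functional of \<open>x\<close>, the rank-one operator
  \<open>v \<mapsto> f v / r * y\<close> takes \<open>x\<close> to \<open>y\<close>.
\<close>

lemma (in banach_space) compactin_cball_if_operator_ball:
  assumes T: "topspace T = UNIV"
    and ball: "compactin (pullback_topology UNIV blinfun_apply (product_topology (\<lambda>_. T) UNIV))
             (bounded_operators smul \<inter> cball 0 1)"
  shows "compactin T (cball 0 r)"
proof (cases "0 < r \<and> (\<exists>z::'a. z \<noteq> 0)")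
  case False
  have "v = 0" if "norm v \<le> r" for v :: 'a
  proof (rule ccontr)
    assume v: "v \<noteq> 0"
    then have "\<not> 0 < r" using False by blast
    then show False using that v zero_less_norm_iff[of v] by linarith
  qed
  \<comment> \<open>Either \<open>r \<le> 0\<close> or the space is trivial.\<close>
  then have "cball 0 r \<subseteq> {0::'a}"
    by auto
  then show ?thesis
    using T by (intro finite_imp_compactin) (auto dest: finite_subset)
next
  case True
  then obtain z :: 'a where r: "0 < r" and z: "z \<noteq> 0" by blast
  define x where "x = (r / norm z) *\<^sub>R z"
  have x: "norm x = r" using r z by (simp add: x_def)
  obtain f where f: "f \<in> dual smul" "norm f \<le> 1" "blinfun_apply f x = of_real r"
    using norming_functional[of x] x by metis
  let ?ev = "\<lambda>S. blinfun_apply S x"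
  have "continuous_map (pullback_topology UNIV blinfun_apply (product_topology (\<lambda>_. T) UNIV)) T
      ((\<lambda>\<phi>. \<phi> x) \<circ> blinfun_apply)"
    by (intro continuous_map_pullback continuous_map_product_projection) simp
  then have "compactin T (?ev ` (bounded_operators smul \<inter> cball 0 1))"
    by (intro image_compactin[OF ball]) (simp add: o_def)
  also have "?ev ` (bounded_operators smul \<inter> cball 0 1) = cball 0 r"
  proof (intro set_eqI iffI)
    fix y assume "y \<in> ?ev ` (bounded_operators smul \<inter> cball 0 1)"
    then obtain S :: "'a \<Rightarrow>\<^sub>L 'a" where "y = blinfun_apply S x" "norm S \<le> 1" by auto
    have "norm S * norm x \<le> 1 * norm x"
      by (intro mult_right_mono) (use \<open>norm S \<le> 1\<close> in auto)
    then show "y \<in> cball 0 r"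
      using norm_blinfun[of S x] x \<open>y = _\<close> by simp
  next
    fix y :: 'a assume "y \<in> cball 0 r"
    then have y: "norm y \<le> r" by simp
    let ?S = "\<lambda>v. smul (blinfun_apply f v / of_real r) y"
    have bound: "norm (?S v) \<le> norm v" for v
    proof -
      have "norm (blinfun_apply f v) \<le> norm v"
        using norm_blinfun[of f v] mult_right_mono[OF f(2), of "norm v"] by simp
      then have "norm (blinfun_apply f v) * norm y \<le> norm v * r"
        using y r by (intro mult_mono) auto
      then show ?thesis
        using r by (simp add: norm_smul norm_divide field_simps)
    qed
    have add: "?S (v + w) = ?S v + ?S w" for v w
      by (simp add: blinfun.add_right add_divide_distrib scale_left_distrib)
    have scale: "?S (smul c v) = smul c (?S v)" for c v
      using f(1) by (simp add: in_dual_iff)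
    have bl: "bounded_linear ?S"
    proof (rule bounded_linear_intro[where K = 1])
      show "?S (a *\<^sub>R v) = a *\<^sub>R ?S v" for a v
        using scale[of "of_real a" v] by (simp only: smul_of_real)
    qed (use add bound in auto)
    have "Vector_Spaces.linear smul smul ?S"
      using vector_space_axioms add scale by (simp add: Vector_Spaces.linear_iff)
    moreover have "norm (Blinfun ?S) \<le> 1"
      by (rule norm_blinfun_bound) (use bound in \<open>simp_all add: bounded_linear_Blinfun_apply[OF bl]\<close>)
    moreover have "?S x = y" using f(3) r by simp
    ultimately show "y \<in> ?ev ` (bounded_operators smul \<inter> cball 0 1)"
      by (intro image_eqI[of _ _ "Blinfun ?S"])
         (simp_all add: bounded_operators_def bounded_linear_Blinfun_apply[OF bl])
  qed
  finally show ?thesis .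
qed

section \<open>Reflexivity and weak compactness of balls\<close>

lemma (in banach_space) dual_add: "f \<in> dual smul \<Longrightarrow> g \<in> dual smul \<Longrightarrow> f + g \<in> dual smul"
  by (simp add: in_dual_iff blinfun.add_left algebra_simps)

lemma (in banach_space) dual_scale: "f \<in> dual smul \<Longrightarrow> blinfun_mult_right c o\<^sub>L f \<in> dual smul"
  by (simp add: in_dual_iff)

lemma (in banach_space) canonical_embedding_in_bidual: "canonical_embedding smul x \<in> bidual smul"
  unfolding bidual_def
proof (intro CollectI conjI ballI allI exI[of _ "norm x"])
  show "canonical_embedding smul x \<in> extensional (dual smul)"
    by (simp add: canonical_embedding_def)
qed (auto simp: canonical_embedding_def dual_add dual_scale blinfun.add_left mult.commute
       intro: norm_blinfun order_trans[OF norm_blinfun])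

lemma (in banach_space) norm_le_if_dual_bound:
  assumes "\<And>f. f \<in> dual smul \<Longrightarrow> norm (blinfun_apply f x) \<le> r * norm f" "0 \<le> r"
  shows "norm x \<le> r"
proof -
  obtain f where f: "f \<in> dual smul" "norm f \<le> 1" "blinfun_apply f x = of_real (norm x)"
    using norming_functional by blast
  then have "norm x \<le> r * norm f"
    using assms(1)[OF f(1)] by simp
  also have "\<dots> \<le> r * 1"
    using f(2) assms(2) by (rule mult_left_mono)
  finally show ?thesis by simp
qed

text \<open>
  For a reflexive space the canonical embedding identifies the ball of radius \<open>r\<close> with the ball of
  the bidual, which is a set of linear points in a product of balls of scalars.
\<close>

lemma (in banach_space) compactin_weak_cball_if_reflexive:
  assumes refl: "reflexive smul"
  shows "compactin (weak_topology smul) (cball 0 r)"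
proof (cases "0 \<le> r")
  case True
  \<comment> \<open>the two sides of the equations that define linearity\<close>
  let ?R = "(\<lambda>(f, g). (\<lambda>\<phi>. \<phi> (f + g), \<lambda>\<phi>. \<phi> f + \<phi> g)) ` (dual smul \<times> dual smul) \<union>
            (\<lambda>(c, f). (\<lambda>\<phi>. \<phi> (blinfun_mult_right c o\<^sub>L f), \<lambda>\<phi>. c * \<phi> f)) ` (UNIV \<times> dual smul)"
  let ?K = "{\<phi> \<in> PiE (dual smul) (\<lambda>f. cball (0::'k) (r * norm f)). \<forall>(p, q)\<in>?R. p \<phi> = q \<phi>}"
  have K: "\<phi> \<in> ?K \<longleftrightarrow> \<phi> \<in> bidual smul \<and> (\<forall>f\<in>dual smul. norm (\<phi> f) \<le> r * norm f)" for \<phi>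
    by (auto simp: bidual_def ball_Un PiE_def Pi_def)
  have "compactin (product_topology (\<lambda>_. euclidean) (dual smul)) ?K"
    by (rule compactin_PiE_equalizers)
       (auto simp: compact_cball_scalar dual_add dual_scale
          intro!: continuous_map_add continuous_map_mult_left continuous_map_product_projection)
  moreover have "canonical_embedding smul ` cball 0 r = ?K"
  proof (intro set_eqI iffI)
    fix \<phi> assume "\<phi> \<in> canonical_embedding smul ` cball 0 r"
    then obtain x where x: "\<phi> = canonical_embedding smul x" "norm x \<le> r" by auto
    have "norm (blinfun_apply f x) \<le> r * norm f" for f :: "'a \<Rightarrow>\<^sub>L 'k"
      using norm_blinfun[of f x] mult_left_mono[OF x(2) norm_ge_zero[of f]]
      by (simp add: mult.commute)
    then show "\<phi> \<in> ?K"
      unfolding K using x canonical_embedding_in_bidual by (auto simp: canonical_embedding_def)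
  next
    fix \<phi> assume "\<phi> \<in> ?K"
    then have \<phi>: "\<phi> \<in> bidual smul" "\<And>f. f \<in> dual smul \<Longrightarrow> norm (\<phi> f) \<le> r * norm f"
      unfolding K by auto
    then obtain x where x: "\<phi> = canonical_embedding smul x"
      using refl by (auto simp: reflexive_def)
    have "norm x \<le> r"
      using \<phi>(2) x True by (intro norm_le_if_dual_bound) (auto simp: canonical_embedding_def)
    then show "\<phi> \<in> canonical_embedding smul ` cball 0 r" using x by auto
  qed
  ultimately show ?thesis
    unfolding weak_topology_def by (intro compactin_pullback_topology) auto
qed simp

lemma (in banach_space) bidual_sum:
  assumes \<phi>: "\<phi> \<in> bidual smul" and F: "finite F" "F \<subseteq> dual smul"
  shows "(\<Sum>f\<in>F. blinfun_mult_right (c f) o\<^sub>L f) \<in> dual smul"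
    and "\<phi> (\<Sum>f\<in>F. blinfun_mult_right (c f) o\<^sub>L f) = (\<Sum>f\<in>F. c f * \<phi> f)"
proof -
  have add: "\<phi> (f + g) = \<phi> f + \<phi> g" if "f \<in> dual smul" "g \<in> dual smul" for f g
    using \<phi> that by (simp add: bidual_def)
  have scale: "\<phi> (blinfun_mult_right a o\<^sub>L f) = a * \<phi> f" if "f \<in> dual smul" for a f
    using \<phi> that by (simp add: bidual_def)
  have z: "0 \<in> dual smul" by (simp add: in_dual_iff)
  have "\<phi> 0 = 0"
    using add[OF z z] by simp
  from F have "(\<Sum>f\<in>F. blinfun_mult_right (c f) o\<^sub>L f) \<in> dual smul \<and>
    \<phi> (\<Sum>f\<in>F. blinfun_mult_right (c f) o\<^sub>L f) = (\<Sum>f\<in>F. c f * \<phi> f)"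
    by (induction F) (simp_all add: z \<open>\<phi> 0 = 0\<close> add scale dual_add dual_scale)
  then show "(\<Sum>f\<in>F. blinfun_mult_right (c f) o\<^sub>L f) \<in> dual smul"
    "\<phi> (\<Sum>f\<in>F. blinfun_mult_right (c f) o\<^sub>L f) = (\<Sum>f\<in>F. c f * \<phi> f)" by auto
qed

text \<open>
  Each \<open>x\<close> can be rotated and scaled to a vector \<open>c x\<close> of norm \<open>M\<close> at which \<open>g\<close> is real and
  nonnegative.
\<close>

lemma (in banach_space) norm_functional_le_if_real_part_le:
  assumes g: "g \<in> dual smul" and M: "0 < M"
    and le: "\<And>v. norm v \<le> M \<Longrightarrow> real_part (blinfun_apply g v) \<le> m"
  shows "M * norm g \<le> m"
proof -
  have m: "0 \<le> m"
    using le[of 0] M real_part_of_real[of 0, where 'k = 'k] by simp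
  have "norm g \<le> m / M"
  proof (rule norm_blinfun_bound)
    fix x
    show "norm (blinfun_apply g x) \<le> m / M * norm x"
    proof (cases "blinfun_apply g x = 0")
      case True
      then show ?thesis using m M by simp
    next
      case False
      then have x: "norm x > 0" by auto
      define c where "c = of_real (norm (blinfun_apply g x) * M / norm x) / blinfun_apply g x"
      have "norm (smul c x) \<le> M"
        using False x M by (simp add: c_def norm_smul norm_divide norm_mult)
      moreover have "blinfun_apply g (smul c x) = of_real (norm (blinfun_apply g x) * M / norm x)"
        using g False by (simp add: in_dual_iff c_def)
      ultimately have "norm (blinfun_apply g x) * M / norm x \<le> m"
        using le[of "smul c x"] real_part_of_real[where 'k = 'k] by metis
      then show ?thesis using x M by (simp add: field_simps)
    qed
  qed (use m M in simp)
  then show ?thesis using M by (simp add: field_simps)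
qed

text \<open>
  This takes the place of Goldstine's theorem and of the separation of convex sets behind it. By weak
  compactness the sum \<open>h y = \<Sum>f. |\<phi> f - f y|^2\<close> has a minimum \<open>y\<close> over the ball. Let
  \<open>d f = \<phi> f - f y\<close> be the errors and \<open>g\<close> the combination of the functionals \<open>f\<close> with the conjugates
  of \<open>d f\<close> as coefficients. As \<open>h\<close> does not decrease from \<open>y\<close> towards any \<open>v\<close> in the ball, the real
  part of \<open>g\<close> is largest at \<open>y\<close>, and so \<open>M * norm g \<le> real_part (g y)\<close>. But
  \<open>\<phi> g = g y + h y\<close> has absolute value at most \<open>M * norm g\<close>, which leaves \<open>h y = 0\<close>.
\<close>

lemma (in banach_space) bidual_interpolation:
  assumes cpt: "compactin (weak_topology smul) (cball 0 M)" and M: "0 < M"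
    and \<phi>: "\<phi> \<in> bidual smul" "\<And>f. f \<in> dual smul \<Longrightarrow> norm (\<phi> f) \<le> M * norm f"
    and F: "finite F" "F \<subseteq> dual smul"
  obtains y where "norm y \<le> M" "\<And>f. f \<in> F \<Longrightarrow> blinfun_apply f y = \<phi> f"
proof -
  define h where "h y = (\<Sum>f\<in>F. (norm (\<phi> f - blinfun_apply f y))\<^sup>2)" for y
  have "continuous_map (weak_topology smul) euclidean h"
    unfolding h_def using F
    by (intro continuous_map_sum continuous_map_real_pow continuous_map_norm continuous_map_diff
        continuous_map_dual[of _ smul]) auto
  then have "compact (h ` cball 0 M)"
    using image_compactin[OF cpt, of euclidean h] by simp
  moreover have "h ` cball 0 M \<noteq> {}"
    using M by simp
  ultimately obtain y where y: "norm y \<le> M" and min: "\<And>v. norm v \<le> M \<Longrightarrow> h y \<le> h v"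
    using compact_attains_inf[of "h ` cball 0 M"] by auto
  define d where "d f = \<phi> f - blinfun_apply f y" for f
  define c where "c f = of_real ((norm (d f))\<^sup>2) / d f" for f
  define g where "g = (\<Sum>f\<in>F. blinfun_mult_right (c f) o\<^sub>L f)"
  have g: "g \<in> dual smul" "\<phi> g = (\<Sum>f\<in>F. c f * \<phi> f)"
    unfolding g_def by (rule bidual_sum[OF \<phi>(1) F])+
  have g_apply: "blinfun_apply g v = (\<Sum>f\<in>F. c f * blinfun_apply f v)" for v
    by (simp add: g_def blinfun.sum_left)
  have hy: "h y = (\<Sum>f\<in>F. (norm (d f))\<^sup>2)"
    by (simp add: h_def d_def)
  have "real_part (blinfun_apply g v) \<le> real_part (blinfun_apply g y)" if v: "norm v \<le> M" for v
  proof (rule ccontr)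
    define b where "b = real_part (blinfun_apply g (v - y))"
    define e where "e = (\<Sum>f\<in>F. (norm (blinfun_apply f (v - y)))\<^sup>2)"
    assume "\<not> ?thesis"
    then have b: "b > 0"
      using linear_diff[OF linear_real_part, of "blinfun_apply g v" "blinfun_apply g y"]
      by (simp add: b_def blinfun.diff_right)
    have e: "e \<ge> 0" by (simp add: e_def sum_nonneg)
    \<comment> \<open>Moving from \<open>y\<close> by \<open>t *\<^sub>R (v - y)\<close> changes \<open>h\<close> by \<open>t * (t * e - 2 * b)\<close>, negative for this \<open>t\<close>.\<close>
    define t where "t = min 1 (b / (e + 1))"
    have t: "0 < t" "t \<le> 1" "t * e < 2 * b"
    proof -
      show "0 < t" "t \<le> 1" using b e by (auto simp: t_def)
      have "t * e \<le> b / (e + 1) * e"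
        using e by (intro mult_right_mono) (auto simp: t_def)
      also have "\<dots> \<le> b" using b e by (simp add: field_simps)
      finally show "t * e < 2 * b" using b by simp
    qed
    have "(1 - t) *\<^sub>R y + t *\<^sub>R v \<in> cball 0 M"
      using y v t convexD[OF convex_cball[of "0::'a" M], of y v "1 - t" t] by simp
    also have "(1 - t) *\<^sub>R y + t *\<^sub>R v = y + t *\<^sub>R (v - y)"
      by (simp add: algebra_simps)
    finally have "h y \<le> h (y + t *\<^sub>R (v - y))"
      by (intro min) simp
    also have "h (y + t *\<^sub>R (v - y)) = (\<Sum>f\<in>F. (norm (d f - t *\<^sub>R blinfun_apply f (v - y)))\<^sup>2)"
      by (simp add: h_def d_def blinfun.add_right blinfun.scaleR_right diff_diff_eq)
    also have "\<dots> = (\<Sum>f\<in>F. (norm (d f))\<^sup>2 - 2 * t * real_part (c f * blinfun_apply f (v - y))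
          + t\<^sup>2 * (norm (blinfun_apply f (v - y)))\<^sup>2)"
      by (simp only: norm_diff_scaleR_square c_def)
    also have "\<dots> = h y - 2 * t * b + t\<^sup>2 * e"
      by (simp add: hy b_def e_def g_apply real_part_sum sum.distrib sum_subtractf sum_distrib_left)
    finally have "t * (2 * b) \<le> t * (t * e)"
      by (simp add: power2_eq_square algebra_simps)
    then show False using t by simp
  qed
  then have Mg: "M * norm g \<le> real_part (blinfun_apply g y)"
    by (rule norm_functional_le_if_real_part_le[OF g(1) M])
  have cd: "c f * d f = of_real ((norm (d f))\<^sup>2)" for f
    by (simp add: c_def)
  have "\<phi> g = (\<Sum>f\<in>F. c f * blinfun_apply f y + c f * d f)"
    unfolding g(2) by (simp add: d_def algebra_simps)
  also have "\<dots> = blinfun_apply g y + of_real (h y)"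
    by (simp add: cd sum.distrib g_apply hy)
  finally have "real_part (\<phi> g) = real_part (blinfun_apply g y) + h y"
    by (simp add: real_part_add)
  moreover have "real_part (\<phi> g) \<le> M * norm g"
    using real_part_le_norm[of "\<phi> g"] \<phi>(2)[OF g(1)] by simp
  ultimately have "h y \<le> 0" using Mg by simp
  then have "(\<Sum>f\<in>F. (norm (d f))\<^sup>2) = 0"
    using hy sum_nonneg[of F "\<lambda>f. (norm (d f))\<^sup>2"] by simp
  then have "\<forall>f\<in>F. d f = 0"
    using F(1) by (simp add: sum_nonneg_eq_0_iff)
  then show thesis
    using y by (intro that[of y]) (auto simp: d_def)
qed

text \<open>
  The sets \<open>{y. f y = \<phi> f}\<close> are weakly closed, and finitely many of them always meet the ball of
  suitable radius. By compactness they all have a common point there.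
\<close>

lemma (in banach_space) reflexive_if_compactin_weak_cball:
  assumes cpt: "\<And>r. compactin (weak_topology smul) (cball 0 r)"
  shows "reflexive smul"
  unfolding reflexive_def
proof (intro subset_antisym subsetI)
  fix \<phi> assume \<phi>: "\<phi> \<in> bidual smul"
  then obtain M0 where M0: "\<And>f. f \<in> dual smul \<Longrightarrow> norm (\<phi> f) \<le> M0 * norm f"
    unfolding bidual_def by blast
  define M where "M = max 1 M0"
  have M: "0 < M" by (simp add: M_def)
  have bound: "norm (\<phi> f) \<le> M * norm f" if "f \<in> dual smul" for f
    using M0[OF that] mult_right_mono[of M0 M "norm f"] by (simp add: M_def)
  let ?C = "\<lambda>f. {y. blinfun_apply f y = \<phi> f}"
  have closed: "closedin (weak_topology smul) (?C f)" if "f \<in> dual smul" for f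
    using closedin_continuous_map_preimage[OF continuous_map_dual[OF that], of "{\<phi> f}"] by simp
  have "cball 0 M \<inter> \<Inter>(?C ` dual smul) \<noteq> {}"
  proof -
    have "cball 0 M \<inter> \<Inter>\<F> \<noteq> {}" if fin: "finite \<F>" "\<F> \<subseteq> ?C ` dual smul" for \<F>
    proof -
      obtain F where F: "finite F" "F \<subseteq> dual smul" "\<F> = ?C ` F"
        using finite_subset_image[OF fin] by blast
      obtain y where "norm y \<le> M" "\<And>f. f \<in> F \<Longrightarrow> blinfun_apply f y = \<phi> f"
        using bidual_interpolation[OF cpt M \<phi> bound F(1,2)] by blast
      then have "y \<in> cball 0 M \<inter> \<Inter>\<F>" using F(3) by auto
      then show ?thesis by blast
    qed
    moreover have "\<forall>C\<in>?C ` dual smul. closedin (weak_topology smul) C"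
      using closed by simp
    ultimately show ?thesis
      using conjunct2[OF iffD1[OF compactin_fip cpt[of M]], THEN spec, of "?C ` dual smul"] by simp
  qed
  then obtain y where y: "\<And>f. f \<in> dual smul \<Longrightarrow> blinfun_apply f y = \<phi> f" by blast
  have "\<phi> = canonical_embedding smul y"
    using \<phi> y by (auto simp: canonical_embedding_def bidual_def fun_eq_iff extensional_def)
  then show "\<phi> \<in> range (canonical_embedding smul)" by blast
qed (use canonical_embedding_in_bidual in blast)

section \<open>Finite dimension and norm compactness of balls\<close>

text \<open>
  Let finitely many balls of radius \<open>1/2\<close> with centres in \<open>B\<close> cover the unit ball. Approximating \<open>x\<close>
  by a centre and doubling the remainder again and again gives \<open>x = \<Sum>i. 2^-i b\<^sub>i\<close> with all \<open>b\<^sub>i\<close> in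
  \<open>B\<close>. Collecting the terms with the same centre turns this series into a finite linear combination of
  \<open>B\<close>.
\<close>

lemma (in banach_space) finite_dimensional_if_compact_cball:
  assumes "compact (cball (0::'a) 1)"
  shows "finite_dimensional smul"
proof -
  obtain B :: "'a set" where B: "finite B" "cball 0 1 \<subseteq> (\<Union>b\<in>B. ball b (1/2))"
    using assms unfolding compact_eq_totally_bounded by (meson half_gt_zero zero_less_one)
  then have "\<forall>x\<in>cball 0 1. \<exists>b\<in>B. norm (x - b) < 1/2"
    by (force simp: dist_norm norm_minus_commute)
  then obtain near where near: "\<And>x. norm x \<le> 1 \<Longrightarrow> near x \<in> B \<and> norm (x - near x) < 1/2"
    by (metis mem_cball_0)
  have ball: "x \<in> module.span smul B" if x: "norm x \<le> 1" for x
  proof -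
    define r where "r = rec_nat x (\<lambda>_ v. 2 *\<^sub>R (v - near v))"
    have r0: "r 0 = x" and rS: "r (Suc n) = 2 *\<^sub>R (r n - near (r n))" for n
      by (simp_all add: r_def)
    have r: "norm (r n) \<le> 1" for n
    proof (induction n)
      case (Suc n)
      then show ?case using near[of "r n"] by (simp add: rS)
    qed (simp add: r0 x)
    have partial: "(\<Sum>i<n. (1/2)^i *\<^sub>R near (r i)) = x - (1/2)^n *\<^sub>R r n" for n
      by (induction n) (simp_all add: r0 rS algebra_simps)
    have "(\<lambda>n. (1/2)^n *\<^sub>R r n) \<longlonglongrightarrow> 0"
    proof (rule Lim_null_comparison)
      show "\<forall>\<^sub>F n in sequentially. norm ((1/2)^n *\<^sub>R r n) \<le> (1/2)^n"
        using r by (simp add: mult_left_le)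
      show "(\<lambda>n. (1/2::real)^n) \<longlonglongrightarrow> 0"
        by (rule LIMSEQ_power_zero) simp
    qed
    from tendsto_diff[OF tendsto_const[of x] this]
    have lim: "(\<lambda>i. (1/2)^i *\<^sub>R near (r i)) sums x"
      by (simp add: sums_def partial)
    \<comment> \<open>the coefficient that the \<open>i\<close>-th term of the series contributes to the centre \<open>b\<close>\<close>
    define a where "a b i = (if near (r i) = b then (1/2)^i else 0 :: real)" for b i
    have "summable (a b)" for b
      by (rule summable_comparison_test'[OF summable_geometric[of "1/2::real"], of 0])
         (auto simp: a_def)
    then have "(\<lambda>i. \<Sum>b\<in>B. a b i *\<^sub>R b) sums (\<Sum>b\<in>B. suminf (a b) *\<^sub>R b)"
      by (intro sums_sum sums_scaleR_left summable_sums)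
    also have "(\<lambda>i. \<Sum>b\<in>B. a b i *\<^sub>R b) = (\<lambda>i. (1/2)^i *\<^sub>R near (r i))"
    proof
      fix i
      have "(\<Sum>b\<in>B. a b i *\<^sub>R b) = (\<Sum>b\<in>B. if b = near (r i) then (1/2)^i *\<^sub>R b else 0)"
        by (intro sum.cong) (auto simp: a_def)
      also have "\<dots> = (1/2)^i *\<^sub>R near (r i)"
        using near[OF r[of i]] B(1) by simp
      finally show "(\<Sum>b\<in>B. a b i *\<^sub>R b) = (1/2)^i *\<^sub>R near (r i)" .
    qed
    finally have "x = (\<Sum>b\<in>B. smul (of_real (suminf (a b))) b)"
      using sums_unique2[OF lim] by (simp add: smul_of_real)
    then show ?thesis
      by (simp only:) (intro span_sum span_scale span_base)
  qed
  have "x \<in> module.span smul B" for x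
  proof -
    have "smul (of_real (norm x)) ((1 / norm x) *\<^sub>R x) \<in> module.span smul B"
      by (intro span_scale ball) simp
    then show ?thesis
      by (cases "x = 0") (simp_all add: smul_of_real span_zero)
  qed
  then show ?thesis
    using B(1) unfolding finite_dimensional_def by blast
qed

lemma closed_if_compact_Int_cball:
  fixes W :: "'a::real_normed_vector set"
  assumes "\<And>r. compact (cball 0 r \<inter> W)"
  shows "closed W"
proof -
  have "a \<in> W" if a: "a \<in> closure W" for a
  proof -
    have "a \<in> closure (ball 0 (norm a + 1) \<inter> W)"
      using a open_Int_closure_subset[of "ball 0 (norm a + 1)" W] by auto
    also have "\<dots> \<subseteq> closure (cball 0 (norm a + 1) \<inter> W)"
      by (intro closure_mono) auto
    also have "\<dots> = cball 0 (norm a + 1) \<inter> W"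
      using assms by (intro closure_closed compact_imp_closed)
    finally show ?thesis by blast
  qed
  then show ?thesis
    using closure_subset_eq by blast
qed

text \<open>
  The span \<open>W\<close> of \<open>B\<close> is closed by induction. If \<open>a\<close> has distance \<open>d > 0\<close> from \<open>W\<close>, then
  \<open>|t| * d \<le> norm (t a + w)\<close> for \<open>w\<close> in \<open>W\<close>. Hence a bound on \<open>t a + w\<close> bounds \<open>t\<close> and \<open>w\<close>
  separately, and both range over compact sets.
\<close>

lemma (in banach_space) compact_cball_Int_span:
  assumes "finite B"
  shows "compact (cball 0 r \<inter> module.span smul B)"
  using assms
proof (induction B arbitrary: r)
  case empty
  have "finite (cball 0 r \<inter> {0::'a})" by simp
  then show ?case by (simp add: finite_imp_compact)
next
  case (insert a B)
  let ?W = "module.span smul B"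
  show ?case
  proof (cases "a \<in> ?W")
    case True
    then show ?thesis using insert by (simp add: span_redundant)
  next
    case False
    have W: "closed ?W"
      by (rule closed_if_compact_Int_cball) (rule insert.IH)
    define d where "d = infdist a ?W"
    have "?W \<noteq> {}" using span_zero by blast
    then have d: "d > 0"
      unfolding d_def using W False by (intro infdist_pos_not_in_closed)
    let ?D = "cball (0::'k) (r / d) \<times> (cball 0 (r + r / d * norm a) \<inter> ?W)"
    let ?p = "\<lambda>(t, w). smul t a + w"
    have "bounded_linear (\<lambda>t. smul t a)"
      by (rule bounded_linear_intro[where K = "norm a"])
         (simp_all add: scale_left_distrib norm_smul scaleR_conv_of_real smul_of_real flip: scale_scale)
    then have "compact (?p ` ?D)"
      unfolding case_prod_unfold
      by (intro compact_continuous_image compact_Times compact_cball_scalar insert.IH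
          continuous_on_add continuous_on_snd continuous_on_id
          bounded_linear.continuous_on[OF _ continuous_on_fst[OF continuous_on_id]])
    moreover have "cball 0 r \<inter> module.span smul (insert a B) = cball 0 r \<inter> ?p ` ?D"
    proof (intro set_eqI iffI)
      fix x assume "x \<in> cball 0 r \<inter> module.span smul (insert a B)"
      then obtain t where x: "norm x \<le> r" and w: "x - smul t a \<in> ?W"
        by (auto simp: span_insert)
      have td: "norm t * d \<le> norm x"
      proof (cases "t = 0")
        case False
        have "smul (- 1 / t) (x - smul t a) \<in> ?W"
          using w by (rule span_scale)
        then have "d \<le> dist a (smul (- 1 / t) (x - smul t a))"
          unfolding d_def by (rule infdist_le)
        also have "a - smul (- 1 / t) (x - smul t a) = smul (1 / t) x"
          using False by (simp add: scale_right_diff_distrib)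
        then have "dist a (smul (- 1 / t) (x - smul t a)) = norm x / norm t"
          by (simp add: dist_norm norm_smul norm_divide)
        finally show ?thesis using False by (simp add: field_simps)
      qed simp
      then have t: "norm t \<le> r / d"
        using d x by (simp add: field_simps)
      have "norm (x - smul t a) \<le> norm x + norm t * norm a"
        using norm_triangle_ineq4[of x "smul t a"] by (simp add: norm_smul)
      also have "\<dots> \<le> r + r / d * norm a"
        using x t by (intro add_mono mult_right_mono) auto
      finally have "(t, x - smul t a) \<in> ?D"
        using t w by simp
      then have "x \<in> ?p ` ?D"
        by (rule rev_image_eqI) simp
      then show "x \<in> cball 0 r \<inter> ?p ` ?D" using x by simp
    next
      fix x assume x: "x \<in> cball 0 r \<inter> ?p ` ?D"
      then obtain t w where "x = smul t a + w" "w \<in> ?W" by auto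
      then have "x - smul t a \<in> ?W" by simp
      then show "x \<in> cball 0 r \<inter> module.span smul (insert a B)"
        using x unfolding span_insert by blast
    qed
    ultimately show ?thesis
      using closed_Int_compact[OF closed_cball] by metis
  qed
qed

theorem proposition3p2:
  fixes smul :: "'k::real_or_complex \<Rightarrow> 'a::banach \<Rightarrow> 'a"
  assumes "banach_space smul"
  shows "(compactin (weak_operator_topology smul) (bounded_operators smul \<inter> cball 0 1)
            \<longleftrightarrow> reflexive smul) \<and>
         (compactin strong_operator_topology (bounded_operators smul \<inter> cball 0 1)
            \<longleftrightarrow> finite_dimensional smul) \<and>
         compactin (weak_star_topology smul) (dual smul \<inter> cball 0 1)"
proof -
  interpret banach_space smul by fact
  show ?thesis
  proof (intro conjI iffI)
    assume "compactin (weak_operator_topology smul) (bounded_operators smul \<inter> cball 0 1)"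
    then show "reflexive smul"
      unfolding weak_operator_topology_def
      by (intro reflexive_if_compactin_weak_cball compactin_cball_if_operator_ball) simp_all
  next
    assume "reflexive smul"
    then show "compactin (weak_operator_topology smul) (bounded_operators smul \<inter> cball 0 1)"
      by (intro compactin_weak_operator_ball compactin_weak_cball_if_reflexive)
  next
    assume "compactin strong_operator_topology (bounded_operators smul \<inter> cball 0 1)"
    then have "compactin euclidean (cball (0::'a) 1)"
      unfolding strong_operator_topology_pullback by (intro compactin_cball_if_operator_ball) simp_all
    then show "finite_dimensional smul"
      by (intro finite_dimensional_if_compact_cball) simp
  next
    assume "finite_dimensional smul"
    then obtain B where "finite B" "module.span smul B = UNIV"
      by (auto simp: finite_dimensional_def)
    then have "compact (cball (0::'a) r)" for r
      using compact_cball_Int_span[of B r] by simp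
    then show "compactin strong_operator_topology (bounded_operators smul \<inter> cball 0 1)"
      by (rule compactin_strong_operator_ball)
  qed (rule compactin_dual_ball)
qed

end
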